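(* Let $P\in\mathbb{R}[x,y]$ be a binary cubic form with discriminant $D_P<0$. Then $$\mathrm{Spec}(P)=\left[0,\sqrt[4]{\frac{-D_P}{23}}\right].$$
   Context: A binary cubic form is a homogeneous polynomial of degree $3$ in two variables with real coefficients; $D_P$ denotes its discriminant (normalized so that $x^3-xy^2-y^3$ has discriminant $-23$). A lattice $\Lambda\subset\mathbb{R}^2$ is unimodular if it has covolume $1$. For a binary form $P$, $$\mathrm{Spec}(P):=\left\{\inf_{v\in\Lambda\setminus\{0\}}|P(v)| : \Lambda\subset\mathbb{R}^2 \text{ a unimodular lattice}\right\}.$$ *)

theory Defs
  imports "HOL-Analysis.Analysis" "HOL-Computational_Algebra.Polynomial"
begin

section \<open>Binary forms\<close>

text \<open>
  The ring of polynomials in x, y over the reals is represented by the type real poly poly.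
  The outer variable is x and the inner variable is y, so that \<open>coeff (coeff P i) j\<close> is the
  coefficient of \<open>x ^ i * y ^ j\<close>.
\<close>

definition binary_form :: "nat \<Rightarrow> real poly poly \<Rightarrow> bool" where
  "binary_form d P \<longleftrightarrow> (\<forall>i j. coeff (coeff P i) j \<noteq> 0 \<longrightarrow> i + j = d)"

definition form_eval :: "real poly poly \<Rightarrow> real ^ 2 \<Rightarrow> real" where
  "form_eval P v = poly (poly P [:v $ 1:]) (v $ 2)"

text \<open>
  The discriminant of \<open>a x^3 + b x^2 y + c x y^2 + d y^3\<close>. On a product of three linear forms
  \<open>p\<^sub>i x - q\<^sub>i y\<close> it equals the product of \<open>(p\<^sub>i q\<^sub>j - p\<^sub>j q\<^sub>i)^2\<close> over \<open>i < j\<close>.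
\<close>

definition cubic_discriminant :: "real poly poly \<Rightarrow> real" where
  "cubic_discriminant P =
    (let a = coeff (coeff P 3) 0; b = coeff (coeff P 2) 1;
         c = coeff (coeff P 1) 2; d = coeff (coeff P 0) 3
     in b\<^sup>2 * c\<^sup>2 - 4 * a * c ^ 3 - 4 * b ^ 3 * d - 27 * a\<^sup>2 * d\<^sup>2 + 18 * a * b * c * d)"

lemma form_eval_cubic:
  assumes "binary_form 3 P"
  shows "form_eval P v =
    coeff (coeff P 3) 0 * (v $ 1) ^ 3 + coeff (coeff P 2) 1 * (v $ 1)\<^sup>2 * v $ 2
    + coeff (coeff P 1) 2 * v $ 1 * (v $ 2)\<^sup>2 + coeff (coeff P 0) 3 * (v $ 2) ^ 3"
proof -
  have z: "coeff (coeff P i) j = 0" if "i + j \<noteq> 3" for i j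
    using assms that unfolding binary_form_def by blast
  have c: "coeff P i = (if i \<le> 3 then monom (coeff (coeff P i) (3 - i)) (3 - i) else 0)" for i
    by (rule poly_eqI) (auto intro!: z)
  have p3: "coeff P 3 = monom (coeff (coeff P 3) 0) 0"
    and p2: "coeff P 2 = monom (coeff (coeff P 2) 1) 1"
    and p1: "coeff P 1 = monom (coeff (coeff P 1) 2) 2"
    and p0: "coeff P 0 = monom (coeff (coeff P 0) 3) 3"
    using c[of 3] c[of 2] c[of 1] c[of 0] by simp_all
  have "degree P \<le> 3"
    by (rule degree_le) (use c in \<open>metis not_le\<close>)
  then have "poly P [:v $ 1:] = (\<Sum>i\<le>3. coeff P i * [:v $ 1:] ^ i)"
    unfolding poly_altdef by (intro sum.mono_neutral_left) (auto intro: coeff_eq_0)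
  also have "\<dots> = coeff P 0 + coeff P 1 * [:v $ 1:] + coeff P 2 * [:v $ 1:]\<^sup>2 + coeff P 3 * [:v $ 1:] ^ 3"
    by (simp add: numeral_3_eq_3 numeral_2_eq_2)
  finally have "form_eval P v = poly (coeff P 0) (v $ 2) + poly (coeff P 1) (v $ 2) * v $ 1
      + poly (coeff P 2) (v $ 2) * (v $ 1)\<^sup>2 + poly (coeff P 3) (v $ 2) * (v $ 1) ^ 3"
    unfolding form_eval_def by simp
  then show ?thesis
    unfolding arg_cong[OF p0, of "\<lambda>q. poly q (v $ 2)"] arg_cong[OF p1, of "\<lambda>q. poly q (v $ 2)"]
      arg_cong[OF p2, of "\<lambda>q. poly q (v $ 2)"] arg_cong[OF p3, of "\<lambda>q. poly q (v $ 2)"]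
    by (simp add: poly_monom algebra_simps)
qed

lemma cubic_discriminant_example:
  fixes P :: "real poly poly"
  defines "P \<equiv> monom 1 3 - monom (monom 1 2) 1 - monom (monom 1 3) 0"
  shows "binary_form 3 P" "form_eval P v = (v $ 1) ^ 3 - v $ 1 * (v $ 2)\<^sup>2 - (v $ 2) ^ 3"
    "cubic_discriminant P = - 23"
  by (auto simp: P_def binary_form_def form_eval_def cubic_discriminant_def poly_monom
      coeff_1 split: if_splits)

section \<open>Lattices\<close>

text \<open>The integer span of the columns of \<open>A\<close>\<close>

definition column_lattice :: "real ^ 'n ^ 'n \<Rightarrow> (real ^ 'n) set" where
  "column_lattice A = {A *v z | z. \<forall>i. z $ i \<in> \<int>}"

definition is_lattice :: "(real ^ 'n) set \<Rightarrow> bool" where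
  "is_lattice L \<longleftrightarrow> (\<exists>A. invertible A \<and> L = column_lattice A)"

definition covolume :: "(real ^ 'n) set \<Rightarrow> real" where
  "covolume L = (THE c. \<exists>A. invertible A \<and> L = column_lattice A \<and> c = \<bar>det A\<bar>)"

definition unimodular_lattice :: "(real ^ 'n) set \<Rightarrow> bool" where
  "unimodular_lattice L \<longleftrightarrow> is_lattice L \<and> covolume L = 1"

lemma column_lattice_subset_det:
  fixes A B :: "real ^ 'n ^ 'n"
  assumes "column_lattice A \<subseteq> column_lattice B"
  shows "\<exists>k\<in>\<int>. det A = det B * k"
proof -
  have "\<exists>z. (\<forall>i. z $ i \<in> \<int>) \<and> A *v axis j 1 = B *v z" for j
  proof -
    have "A *v axis j 1 \<in> column_lattice A"
      unfolding column_lattice_def axis_def by (intro CollectI exI conjI refl) auto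
    then show ?thesis using assms unfolding column_lattice_def by blast
  qed
  then obtain z where z: "\<And>j i. z j $ i \<in> \<int>" "\<And>j. A *v axis j 1 = B *v z j" by metis
  define M :: "real ^ 'n ^ 'n" where "M = (\<chi> i j. z j $ i)"
  have "A $ i $ j = (B ** M) $ i $ j" for i j
  proof -
    have "A $ i $ j = (A *v axis j 1) $ i"
      by (simp add: matrix_vector_mult_basis column_def)
    also have "\<dots> = (B ** M) $ i $ j"
      unfolding z(2) by (simp add: M_def matrix_matrix_mult_def matrix_vector_mult_def)
    finally show ?thesis .
  qed
  then have "A = B ** M" by (simp add: vec_eq_iff)
  moreover have "det M \<in> \<int>"
    unfolding det_def M_def by (intro Ints_sum Ints_mult Ints_prod Ints_of_int) (auto intro: z)
  ultimately show ?thesis by (auto simp: det_mul)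
qed

lemma covolume_column_lattice:
  assumes "invertible A"
  shows "covolume (column_lattice A) = \<bar>det A\<bar>"
  unfolding covolume_def
proof (rule the_equality)
  fix c assume "\<exists>B. invertible B \<and> column_lattice A = column_lattice B \<and> c = \<bar>det B\<bar>"
  then obtain B where B: "invertible B" "column_lattice A = column_lattice B" "c = \<bar>det B\<bar>" by blast
  have le: "\<bar>det C\<bar> \<le> \<bar>det D\<bar>"
    if inv: "invertible D" and eq: "column_lattice C = column_lattice D" for C D :: "real ^ 'a ^ 'a"
  proof -
    obtain k where k: "k \<in> \<int>" "det D = det C * k"
      using column_lattice_subset_det[of D C] eq by auto
    have "k \<noteq> 0" using inv k(2) by (auto simp: invertible_det_nz)
    then have "1 \<le> \<bar>k\<bar>" using k(1) by (rule Ints_nonzero_abs_ge1[rotated])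
    then show ?thesis unfolding k(2) abs_mult by (simp add: mult_le_cancel_left1)
  qed
  show "c = \<bar>det A\<bar>"
    using le[OF B(1) B(2)] le[OF assms B(2)[symmetric]] B(3) by linarith
qed (use assms in blast)

section \<open>The spectrum\<close>

definition Spec :: "real poly poly \<Rightarrow> real set" where
  "Spec P = {(INF v\<in>L - {0}. \<bar>form_eval P v\<bar>) | L. unimodular_lattice L}"

end

theory Submission
  imports Defs
begin

text \<open>
  A real cubic form of negative discriminant is a linear form times a definite quadratic form, and
  a linear substitution carries it to \<open>x (x\<^sup>2 + y\<^sup>2)\<close>; the sixth power of the determinant of the
  substitution is fixed by the discriminant. Two forms with the same negative discriminant therefore
  differ by a substitution of determinant \<open>\<plusminus>1\<close>, and the spectrum of \<open>P\<close> is the set of the values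
  \<open>inf \<bar>f\<bar>\<close> over the nonzero integer points, where \<open>f\<close> runs through all cubic forms with
  the discriminant of \<open>P\<close> (\<open>Spec_eq_integer_minima\<close>). By homogeneity it remains to show two things.

  First, a form of negative discriminant with \<open>\<bar>f\<bar> \<ge> 1\<close> at all nonzero integer points has
  discriminant at most \<open>-23\<close> (Mordell's theorem, \<open>cubic_disc_upper_bound\<close>). After a change of basis of the integer lattice and
  of the signs, \<open>f = (x + t y) (P x\<^sup>2 + Q x y + R y\<^sup>2)\<close> with \<open>t > 0\<close> and a reduced quadratic factor,
  that is \<open>\<bar>Q\<bar> \<le> P \<le> R\<close>. Minus the discriminant is \<open>(4 P R - Q\<^sup>2) N\<^sup>2\<close>, where
  \<open>N = P t\<^sup>2 - Q t + R\<close>, and the conditions at the four points \<open>(1, 0)\<close>, \<open>(0, 1)\<close>, \<open>(1, -1)\<close>,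
  \<open>(1, -2)\<close> suffice. If \<open>R\<close> is large or if \<open>t > 1\<close>, crude estimates of the two factors are enough.
  Otherwise \<open>1 / 2 < t < 1\<close>. Then lowering \<open>P\<close> and \<open>Q\<close> by the same amount does not increase the
  expression and, as long as \<open>P \<ge> 1\<close>, respects the conditions, so that \<open>P = 1\<close> may be assumed,
  apart from an easy case; what is left is a polynomial inequality in the coefficients of \<open>f\<close>, with equality exactly
  when the values at the four points are \<open>1, 1, 1, -1\<close>.

  Second, every \<open>D \<le> -23\<close> is the discriminant of a form whose minimum is exactly \<open>1\<close>
  (\<open>cubic_with_minimum_one\<close>). Let \<open>\<theta>\<close> be the real root of \<open>x\<^sup>3 - x - 1\<close>. In the family
  \<open>x\<^sup>3 - x y\<^sup>2 - y\<^sup>3 + u (x - \<theta> y) y\<^sup>2\<close>, \<open>u \<ge> 0\<close>, the linear factor is constant and the quadratic factor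
  grows with \<open>u\<close>, so that absolute values are at least those at \<open>u = 0\<close>, which are nonzero integers
  at nonzero integer points; and the value at \<open>(1, 0)\<close> is always \<open>1\<close>. The discriminant moves
  continuously from \<open>-23\<close> to \<open>-\<infinity>\<close>. The value \<open>0\<close> of the spectrum comes from a form that vanishes
  at \<open>(1, 0)\<close>.
\<close>

section \<open>Cubic forms with negative discriminant\<close>

text \<open>The form \<open>a x\<^sup>3 + b x\<^sup>2 y + c x y\<^sup>2 + d y\<^sup>3\<close>, as a function of two real variables.\<close>

definition cubic :: "real \<Rightarrow> real \<Rightarrow> real \<Rightarrow> real \<Rightarrow> real \<Rightarrow> real \<Rightarrow> real" where
  "cubic a b c d x y = a * x ^ 3 + b * x\<^sup>2 * y + c * x * y\<^sup>2 + d * y ^ 3"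

text \<open>The discriminant of that form, as in \<^const>\<open>cubic_discriminant\<close>.\<close>

definition cubic_disc :: "real \<Rightarrow> real \<Rightarrow> real \<Rightarrow> real \<Rightarrow> real" where
  "cubic_disc a b c d =
    b\<^sup>2 * c\<^sup>2 - 4 * a * c ^ 3 - 4 * b ^ 3 * d - 27 * a\<^sup>2 * d\<^sup>2 + 18 * a * b * c * d"

text \<open>The binary quadratic form \<open>P x\<^sup>2 + Q x y + R y\<^sup>2\<close>.\<close>

definition qform :: "real \<Rightarrow> real \<Rightarrow> real \<Rightarrow> real \<Rightarrow> real \<Rightarrow> real" where
  "qform P Q R x y = P * x\<^sup>2 + Q * x * y + R * y\<^sup>2"

text \<open>
  Twice the symmetric bilinear form of that quadratic form, at the vectors \<open>(p, r)\<close> and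
  \<open>(q, s)\<close>; it is the middle coefficient of the form in the basis of these two vectors.
\<close>

definition qpolar :: "real \<Rightarrow> real \<Rightarrow> real \<Rightarrow> real \<Rightarrow> real \<Rightarrow> real \<Rightarrow> real \<Rightarrow> real" where
  "qpolar P Q R p r q s = 2 * P * p * q + Q * (p * s + q * r) + 2 * R * r * s"

lemma qform_substitution:
  "qform P Q R (p * x + q * y) (r * x + s * y)
    = qform (qform P Q R p r) (qpolar P Q R p r q s) (qform P Q R q s) x y"
  unfolding qform_def qpolar_def by algebra

lemma qform_disc_substitution:
  "4 * qform P Q R p r * qform P Q R q s - (qpolar P Q R p r q s)\<^sup>2
    = (p * s - q * r)\<^sup>2 * (4 * P * R - Q\<^sup>2)"
  unfolding qform_def qpolar_def by algebra

text \<open>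
  \<open>P \<phi>\<^sup>2 - Q \<phi> \<theta> + R \<theta>\<^sup>2\<close> is the value of the quadratic form at the zero \<open>(\<phi>, -\<theta>)\<close> of the linear
  form \<open>\<theta> x + \<phi> y\<close>, that is, the resultant of the two forms.
\<close>

lemma qform_root_substitution:
  "qform P Q R p r * (\<theta> * q + \<phi> * s)\<^sup>2 - qpolar P Q R p r q s * (\<theta> * q + \<phi> * s) * (\<theta> * p + \<phi> * r)
      + qform P Q R q s * (\<theta> * p + \<phi> * r)\<^sup>2
    = (p * s - q * r)\<^sup>2 * (P * \<phi>\<^sup>2 - Q * \<phi> * \<theta> + R * \<theta>\<^sup>2)"
  unfolding qform_def qpolar_def by algebra

lemma cubic_factored:
  "cubic (\<theta> * P) (\<theta> * Q + \<phi> * P) (\<theta> * R + \<phi> * Q) (\<phi> * R) x y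
    = (\<theta> * x + \<phi> * y) * qform P Q R x y"
  unfolding cubic_def qform_def by algebra

lemma cubic_disc_factored:
  "cubic_disc (\<theta> * P) (\<theta> * Q + \<phi> * P) (\<theta> * R + \<phi> * Q) (\<phi> * R)
    = - ((4 * P * R - Q\<^sup>2) * (P * \<phi>\<^sup>2 - Q * \<phi> * \<theta> + R * \<theta>\<^sup>2)\<^sup>2)"
  unfolding cubic_disc_def by algebra

lemma cubic_disc_scale: "cubic_disc (k * a) (k * b) (k * c) (k * d) = k ^ 4 * cubic_disc a b c d"
  unfolding cubic_disc_def by algebra

lemma real_cubic_root:
  fixes a b c d :: real
  assumes "a \<noteq> 0"
  shows "\<exists>s. a * s ^ 3 + b * s\<^sup>2 + c * s + d = 0"
proof -
  define B C D where "B = b / a" and "C = c / a" and "D = d / a"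
  define p where "p = (\<lambda>s. s ^ 3 + B * s\<^sup>2 + C * s + D)"
  define M where "M = 1 + \<bar>B\<bar> + \<bar>C\<bar> + \<bar>D\<bar>"
  have M1: "M \<ge> 1" by (simp add: M_def)
  have main: "\<bar>B * s\<^sup>2 + C * s + D\<bar> \<le> M ^ 3" if "\<bar>s\<bar> = M" for s
  proof -
    have M2: "M \<le> M\<^sup>2" "1 \<le> M\<^sup>2" using M1 by (simp_all add: self_le_power)
    have s2: "s\<^sup>2 = M\<^sup>2" using that by (metis power2_abs)
    have "\<bar>B * s\<^sup>2 + C * s + D\<bar> \<le> \<bar>B * s\<^sup>2\<bar> + \<bar>C * s\<bar> + \<bar>D\<bar>" by linarith
    also have "\<dots> = \<bar>B\<bar> * M\<^sup>2 + \<bar>C\<bar> * M + \<bar>D\<bar>" using that by (simp add: abs_mult s2)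
    also have "\<dots> \<le> \<bar>B\<bar> * M\<^sup>2 + \<bar>C\<bar> * M\<^sup>2 + \<bar>D\<bar> * M\<^sup>2"
      using M2 mult_left_mono[of M "M\<^sup>2" "\<bar>C\<bar>"] mult_left_mono[of 1 "M\<^sup>2" "\<bar>D\<bar>"] by simp
    also have "\<dots> = (M - 1) * M\<^sup>2" by (simp add: M_def algebra_simps)
    also have "\<dots> \<le> M ^ 3" by (simp add: power3_eq_cube power2_eq_square algebra_simps)
    finally show ?thesis .
  qed
  have "p (- M) \<le> 0" "0 \<le> p M"
    using main[of "- M"] main[of M] M1 by (auto simp: p_def)
  moreover have "continuous_on {- M..M} p" unfolding p_def by (intro continuous_intros)
  ultimately obtain s where "p s = 0" using IVT'[of p "- M" 0 M] M1 by auto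
  then have "a * p s = 0" by simp
  then have "a * s ^ 3 + b * s\<^sup>2 + c * s + d = 0"
    using assms by (simp add: p_def B_def C_def D_def algebra_simps)
  then show ?thesis ..
qed

lemma cubic_factorization:
  assumes "cubic_disc a b c d < 0"
  obtains \<theta> \<phi> P Q R where "P > 0" "4 * P * R - Q\<^sup>2 > 0" "P * \<phi>\<^sup>2 - Q * \<phi> * \<theta> + R * \<theta>\<^sup>2 > 0"
    "a = \<theta> * P" "b = \<theta> * Q + \<phi> * P" "c = \<theta> * R + \<phi> * Q" "d = \<phi> * R"
proof -
  have "\<exists>\<theta> \<phi> P Q R. a = \<theta> * P \<and> b = \<theta> * Q + \<phi> * P \<and> c = \<theta> * R + \<phi> * Q \<and> d = \<phi> * R"
  proof (cases "a = 0")
    case True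
    then show ?thesis by (intro exI[of _ 0] exI[of _ 1] exI[of _ b] exI[of _ c] exI[of _ d]) auto
  next
    case False
    then obtain s where "a * s ^ 3 + b * s\<^sup>2 + c * s + d = 0" using real_cubic_root by blast
    then have "d = - s * (c + b * s + a * s\<^sup>2)" by (simp add: algebra_simps power2_eq_square power3_eq_cube)
    then show ?thesis
      by (intro exI[of _ 1] exI[of _ "- s"] exI[of _ a] exI[of _ "b + a * s"] exI[of _ "c + b * s + a * s\<^sup>2"])
        (auto simp: algebra_simps power2_eq_square)
  qed
  then obtain \<theta> \<phi> P Q R where f:
    "a = \<theta> * P" "b = \<theta> * Q + \<phi> * P" "c = \<theta> * R + \<phi> * Q" "d = \<phi> * R" by blast
  define N where "N = P * \<phi>\<^sup>2 - Q * \<phi> * \<theta> + R * \<theta>\<^sup>2"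
  have "(4 * P * R - Q\<^sup>2) * N\<^sup>2 > 0"
    using assms unfolding f cubic_disc_factored N_def by simp
  then have D: "4 * P * R - Q\<^sup>2 > 0" and N: "N \<noteq> 0"
    by (auto simp: zero_less_mult_iff)
  then have P: "P \<noteq> 0" by auto
  have "4 * P * N = (2 * P * \<phi> - Q * \<theta>)\<^sup>2 + (4 * P * R - Q\<^sup>2) * \<theta>\<^sup>2"
    unfolding N_def by algebra
  then have "4 * P * N \<ge> 0" using D by simp
  then have PN: "P * N > 0" using P N by (simp add: zero_le_mult_iff zero_less_mult_iff) linarith
  show ?thesis
  proof (cases "P > 0")
    case True
    with PN have "N > 0" by (simp add: zero_less_mult_iff)
    then show ?thesis using that[of P R Q \<phi> \<theta>] True D f N_def by simp
  next
    case False
    with P PN have "P < 0" "N < 0" by (auto simp: zero_less_mult_iff)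
    then show ?thesis using that[of "- P" "- R" "- Q" "- \<phi>" "- \<theta>"] D f N_def by (simp add: algebra_simps)
  qed
qed

text \<open>
  If \<open>L\<close> and \<open>q\<close> are the two factors, \<open>\<Delta>\<close> is minus the discriminant of \<open>q\<close>, \<open>N\<close> its
  value at a zero of \<open>L\<close>, and \<open>M\<close> the bilinear form of \<open>q\<close> with that zero, then
  \<open>N q = M\<^sup>2 + (\<Delta> / 4) L\<^sup>2\<close>. The new variables are multiples of \<open>L\<close> and \<open>M\<close>.
\<close>

lemma cubic_normal_form:
  assumes "cubic_disc a b c d < 0"
  shows "\<exists>p q r s. (\<forall>x y. cubic a b c d x y = cubic 1 0 1 0 (p * x + q * y) (r * x + s * y))
    \<and> (p * s - q * r) ^ 6 = - cubic_disc a b c d / 4"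
proof -
  obtain \<theta> \<phi> P Q R where PQR: "P > 0" "4 * P * R - Q\<^sup>2 > 0" "P * \<phi>\<^sup>2 - Q * \<phi> * \<theta> + R * \<theta>\<^sup>2 > 0"
    and f: "a = \<theta> * P" "b = \<theta> * Q + \<phi> * P" "c = \<theta> * R + \<phi> * Q" "d = \<phi> * R"
    by (rule cubic_factorization[OF assms])
  define N where "N = P * \<phi>\<^sup>2 - Q * \<phi> * \<theta> + R * \<theta>\<^sup>2"
  define \<Delta> where "\<Delta> = 4 * P * R - Q\<^sup>2"
  define k where "k = root 3 (\<Delta> / (4 * N))"
  define m where "m = sqrt (1 / (k * N))"
  have pos: "N > 0" "\<Delta> > 0" using PQR by (auto simp: N_def \<Delta>_def)
  have k: "k > 0" "k ^ 3 = \<Delta> / (4 * N)" using pos by (auto simp: k_def)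
  have m: "m\<^sup>2 = 1 / (k * N)" using pos k by (simp add: m_def)
  have km: "N * (k * m\<^sup>2) = 1" "4 * N * k ^ 3 = \<Delta>" using m k pos by simp_all
  define u v where "u = P * \<phi> - Q * \<theta> / 2" and "v = Q * \<phi> / 2 - R * \<theta>"
  have "cubic a b c d x y = cubic 1 0 1 0 (k * \<theta> * x + k * \<phi> * y) (m * u * x + m * v * y)" for x y
  proof -
    have "N * cubic 1 0 1 0 (k * \<theta> * x + k * \<phi> * y) (m * u * x + m * v * y)
      = (\<theta> * x + \<phi> * y) * (N * k ^ 3 * (\<theta> * x + \<phi> * y)\<^sup>2 + N * (k * m\<^sup>2) * (u * x + v * y)\<^sup>2)"
      unfolding cubic_def by algebra
    also have "\<dots> = (\<theta> * x + \<phi> * y) * (\<Delta> / 4 * (\<theta> * x + \<phi> * y)\<^sup>2 + (u * x + v * y)\<^sup>2)"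
      using km by simp
    also have "\<Delta> / 4 * (\<theta> * x + \<phi> * y)\<^sup>2 + (u * x + v * y)\<^sup>2 = N * qform P Q R x y"
      unfolding qform_def \<Delta>_def u_def v_def N_def by (simp add: field_simps power2_eq_square)
    finally show ?thesis using pos(1) unfolding f cubic_factored by simp
  qed
  moreover have "(k * \<theta> * (m * v) - k * \<phi> * (m * u)) ^ 6 = - cubic_disc a b c d / 4"
  proof -
    have "k * \<theta> * (m * v) - k * \<phi> * (m * u) = - (k * m * N)"
      unfolding u_def v_def N_def by (simp add: field_simps power2_eq_square)
    then have "(k * \<theta> * (m * v) - k * \<phi> * (m * u)) ^ 6 = k ^ 3 * (N * (k * m\<^sup>2)) ^ 3 * N ^ 3"
      by (simp add: power_mult_distrib flip: power_mult power_add) (simp add: algebra_simps flip: power_add power_mult)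
    also have "\<dots> = \<Delta> * N\<^sup>2 / 4"
      unfolding km k(2) using pos by (simp add: field_simps power2_eq_square power3_eq_cube)
    finally show ?thesis unfolding f cubic_disc_factored N_def \<Delta>_def by simp
  qed
  ultimately show ?thesis by blast
qed

section \<open>Reduction of positive definite binary quadratic forms\<close>

lemma finite_qform_sublevel:
  assumes "P > 0" "4 * P * R - Q\<^sup>2 > 0"
  shows "finite {(x :: int, y :: int). qform P Q R x y \<le> K}"
proof -
  have R: "R > 0"
  proof -
    have "0 < P * R" using assms(2) zero_le_power2[of Q] by linarith
    then show ?thesis using assms(1) by (simp add: zero_less_mult_iff)
  qed
  define \<Delta> where "\<Delta> = 4 * P * R - Q\<^sup>2"
  define M where "M = max (4 * R * K / \<Delta>) (4 * P * K / \<Delta>)"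
  have bound: "\<bar>z\<bar> \<le> \<lceil>M\<rceil>" if "real_of_int z ^ 2 \<le> M" for z :: int
  proof -
    have "\<bar>z\<bar> \<le> z\<^sup>2"
    proof (cases "z = 0")
      case False
      then have "1 \<le> \<bar>z\<bar>" by simp
      then have "\<bar>z\<bar> \<le> \<bar>z\<bar>\<^sup>2" by (rule self_le_power) simp
      then show ?thesis by simp
    qed simp
    then have "real_of_int \<bar>z\<bar> \<le> real_of_int (z\<^sup>2)" by (simp only: of_int_le_iff)
    then have "real_of_int \<bar>z\<bar> \<le> M" using that by simp
    then show ?thesis by linarith
  qed
  have "\<bar>x\<bar> \<le> \<lceil>M\<rceil> \<and> \<bar>y\<bar> \<le> \<lceil>M\<rceil>" if "qform P Q R x y \<le> K" for x y :: int
  proof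
    have "4 * R * qform P Q R x y = (2 * R * y + Q * x)\<^sup>2 + \<Delta> * x ^ 2"
      unfolding qform_def \<Delta>_def of_int_power by algebra
    then have "\<Delta> * x ^ 2 \<le> 4 * R * qform P Q R x y" by simp
    also have "\<dots> \<le> 4 * R * K" using R that by simp
    finally have "x ^ 2 \<le> 4 * R * K / \<Delta>" using assms by (simp add: \<Delta>_def field_simps)
    then show "\<bar>x\<bar> \<le> \<lceil>M\<rceil>" by (intro bound) (simp add: M_def)
    have "4 * P * qform P Q R x y = (2 * P * x + Q * y)\<^sup>2 + \<Delta> * y ^ 2"
      unfolding qform_def \<Delta>_def of_int_power by algebra
    then have "\<Delta> * y ^ 2 \<le> 4 * P * qform P Q R x y" by simp
    also have "\<dots> \<le> 4 * P * K" using assms that by simp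
    finally have "y ^ 2 \<le> 4 * P * K / \<Delta>" using assms by (simp add: \<Delta>_def field_simps)
    then show "\<bar>y\<bar> \<le> \<lceil>M\<rceil>" by (intro bound) (simp add: M_def)
  qed
  then have "{(x :: int, y :: int). qform P Q R x y \<le> K} \<subseteq> {- \<lceil>M\<rceil>..\<lceil>M\<rceil>} \<times> {- \<lceil>M\<rceil>..\<lceil>M\<rceil>}"
    by (fastforce simp: abs_le_iff)
  then show ?thesis by (rule finite_subset) simp
qed

lemma qform_pos:
  assumes "P > 0" "4 * P * R - Q\<^sup>2 > 0" "(x, y) \<noteq> (0, 0)"
  shows "qform P Q R x y > 0"
proof -
  have "4 * P * qform P Q R x y = (2 * P * x + Q * y)\<^sup>2 + (4 * P * R - Q\<^sup>2) * y\<^sup>2"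
    unfolding qform_def by algebra
  also have "\<dots> > 0"
  proof (cases "y = 0")
    case True
    then show ?thesis using assms by simp
  next
    case False
    then have "0 < (4 * P * R - Q\<^sup>2) * y\<^sup>2" using assms by simp
    then show ?thesis by (simp add: add_nonneg_pos)
  qed
  finally show ?thesis using assms by (simp add: zero_less_mult_iff)
qed

text \<open>
  A basis of \<open>\<int>\<^sup>2\<close> with the least possible sum of the values of the form at its two
  vectors is reduced, up to the order of the vectors: adding \<open>\<plusminus>\<close> one vector to the other does not
  lower the sum.
\<close>

lemma qform_reduced_basis:
  fixes P Q R :: real
  assumes PQR: "P > 0" "4 * P * R - Q\<^sup>2 > 0"
  obtains m n k l :: int where "\<bar>m * l - n * k\<bar> = 1"
    "\<bar>qpolar P Q R m n k l\<bar> \<le> qform P Q R m n"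
    "qform P Q R m n \<le> qform P Q R k l"
proof -
  let ?q = "\<lambda>(x :: int) (y :: int). qform P Q R x y"
  define S where "S = {((m, n), (k, l)). \<bar>m * l - n * k\<bar> = 1 \<and> ?q m n + ?q k l \<le> ?q 1 0 + ?q 0 1}"
  define \<mu> where "\<mu> = (\<lambda>((m, n), (k, l)). ?q m n + ?q k l)"
  have nn: "?q x y \<ge> 0" for x y
    using qform_pos[OF PQR, of x y] by (cases "(x, y) = (0, 0)") (auto simp: qform_def)
  have "S \<subseteq> {(x, y). ?q x y \<le> ?q 1 0 + ?q 0 1} \<times> {(x, y). ?q x y \<le> ?q 1 0 + ?q 0 1}"
    using nn unfolding S_def by (auto, smt (verit) nn, smt (verit) nn)
  then have "finite S" by (rule finite_subset) (intro finite_cartesian_product finite_qform_sublevel PQR)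
  moreover have "((1, 0), (0, 1)) \<in> S" by (simp add: S_def)
  ultimately obtain z where "is_arg_min \<mu> (\<lambda>z. z \<in> S) z"
    using ex_is_arg_min_if_finite[of S \<mu>] by auto
  then have z: "z \<in> S" "\<And>w. w \<in> S \<Longrightarrow> \<mu> z \<le> \<mu> w" by (auto simp: is_arg_min_linorder)
  obtain m n k l where zz: "z = ((m, n), (k, l))" by (metis surj_pair)
  have det: "\<bar>m * l - n * k\<bar> = 1" and le: "?q m n + ?q k l \<le> ?q 1 0 + ?q 0 1"
    using z(1) by (auto simp: S_def zz)
  have min: "?q m n + ?q k l \<le> ?q m' n' + ?q k' l'" if "\<bar>m' * l' - n' * k'\<bar> = 1" for m' n' k' l'
  proof (cases "?q m' n' + ?q k' l' \<le> ?q 1 0 + ?q 0 1")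
    case True
    then show ?thesis using z(2)[of "((m', n'), (k', l'))"] that by (simp add: S_def zz \<mu>_def)
  next
    case False
    then show ?thesis using le by simp
  qed
  define B where "B = qpolar P Q R m n k l"
  have add: "?q (m + j * k) (n + j * l) = ?q m n + j * B + j\<^sup>2 * ?q k l" for j :: int
    unfolding qform_def qpolar_def B_def of_int_add of_int_mult of_int_power by algebra
  have add': "?q (k + j * m) (l + j * n) = ?q k l + j * B + j\<^sup>2 * ?q m n" for j :: int
    unfolding qform_def qpolar_def B_def of_int_add of_int_mult of_int_power by algebra
  have dets: "\<bar>(m + j * k) * l - (n + j * l) * k\<bar> = 1" "\<bar>m * (l + j * n) - n * (k + j * m)\<bar> = 1" for j
    using det by (simp_all add: algebra_simps)
  have 1: "\<bar>B\<bar> \<le> ?q k l"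
    using min[OF dets(1)[of 1]] min[OF dets(1)[of "-1"]] add[of 1] add[of "-1"] by simp
  have 2: "\<bar>B\<bar> \<le> ?q m n"
    using min[OF dets(2)[of 1]] min[OF dets(2)[of "-1"]] add'[of 1] add'[of "-1"] by simp
  show ?thesis
  proof (cases "?q m n \<le> ?q k l")
    case True
    then show ?thesis using that[of m l n k] det 2 by (simp add: B_def)
  next
    case False
    have "\<bar>k * n - l * m\<bar> = 1" using det by (simp add: abs_minus_commute mult.commute)
    then show ?thesis using that[of k n l m] False 1 by (simp add: B_def qpolar_def algebra_simps)
  qed
qed

section \<open>Monotonicity of the discriminant\<close>

text \<open>
  The family \<open>(x + t y) ((P - s) x\<^sup>2 + (Q - s) x y + R y\<^sup>2)\<close> has constant values at \<open>(0, 1)\<close> and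
  \<open>(1, -1)\<close>, because the term in \<open>s\<close> is divisible by \<open>x (x + y)\<close>.
\<close>

lemma factored_disc_mono:
  fixes P Q R t e :: real
  assumes t: "0 \<le> t" "t \<le> 1" and e: "0 \<le> e" "e \<le> P" and "Q \<le> P" "P \<le> R"
  shows "(4 * (P - e) * R - (Q - e)\<^sup>2) * ((P - e) * t\<^sup>2 - (Q - e) * t + R)\<^sup>2
    \<le> (4 * P * R - Q\<^sup>2) * (P * t\<^sup>2 - Q * t + R)\<^sup>2"
proof -
  have tt: "t * (1 - t) \<le> 1 / 4"
    using zero_le_square[of "2 * t - 1"] by (simp add: algebra_simps)
  have tt0: "0 \<le> t * (1 - t)" using t by simp
  define h where "h = (\<lambda>s. (4 * (P - s) * R - (Q - s)\<^sup>2) * ((P - s) * t\<^sup>2 - (Q - s) * t + R)\<^sup>2)"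
  have "h e \<le> h 0"
  proof (rule DERIV_nonpos_imp_nonincreasing[OF e(1)])
    fix s assume s: "0 \<le> s" "s \<le> e"
    define p q \<beta> where "p = P - s" and "q = Q - s" and "\<beta> = R - p"
    have pq: "0 \<le> p" "q \<le> p" "0 \<le> \<beta>" using s e assms by (auto simp: p_def q_def \<beta>_def)
    define N where "N = p * t\<^sup>2 - q * t + R"
    have pt: "p * (t * (1 - t)) \<le> p / 4" using mult_left_mono[OF tt pq(1)] by simp
    have "N = \<beta> + (p - q) * t + p - p * (t * (1 - t))"
      unfolding N_def \<beta>_def by (simp add: algebra_simps power2_eq_square)
    moreover have "0 \<le> (p - q) * t" using pq t by simp
    ultimately have N: "N \<ge> 0" using pt pq by linarith
    \<comment> \<open>up to the factor \<open>- 2 * N\<close>, this is the derivative of \<open>h\<close>, which is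
      expanded in the nonnegative quantities \<open>\<beta>\<close>, \<open>p\<close> and \<open>p - q\<close>\<close>
    have "(2 * R - q) * N - t * (1 - t) * (4 * p * R - q\<^sup>2)
      = 2 * \<beta>\<^sup>2 + \<beta> * ((2 * p - q) + 2 * ((p - q) * t) + 2 * p - 6 * (p * (t * (1 - t))))
        + (2 * p - q) * (p * (1 - 2 * t)\<^sup>2 + (p - q) * (t + t * (1 - t)))"
      unfolding N_def \<beta>_def by algebra
    moreover have "0 \<le> (2 * p - q) + 2 * ((p - q) * t) + 2 * p - 6 * (p * (t * (1 - t)))"
      using pq pt \<open>0 \<le> (p - q) * t\<close> by linarith
    moreover have "0 \<le> (2 * p - q) * (p * (1 - 2 * t)\<^sup>2 + (p - q) * (t + t * (1 - t)))"
      using pq t tt0 by (intro mult_nonneg_nonneg add_nonneg_nonneg) auto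
    ultimately have K: "0 \<le> (2 * R - q) * N - t * (1 - t) * (4 * p * R - q\<^sup>2)"
      using pq by simp
    have "(h has_real_derivative - (2 * N * ((2 * R - q) * N - t * (1 - t) * (4 * p * R - q\<^sup>2)))) (at s)"
      unfolding h_def N_def p_def q_def
      by (auto intro!: derivative_eq_intros) algebra
    then show "\<exists>y. (h has_real_derivative y) (at s) \<and> y \<le> 0"
      using N K by (intro exI conjI) auto
  qed
  then show ?thesis by (simp add: h_def)
qed

section \<open>The discriminant of a product with reduced quadratic factor\<close>

lemma reduced_form_bounds:
  fixes P Q R t :: real
  assumes "1 \<le> P" "\<bar>Q\<bar> \<le> P" "P \<le> R"
  shows "P * (4 * R - P) \<le> 4 * P * R - Q\<^sup>2" "4 * R - 1 \<le> 4 * P * R - Q\<^sup>2"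
    "4 * R - P \<le> 4 * (P * t\<^sup>2 - Q * t + R)"
proof -
  have Q: "Q\<^sup>2 \<le> P\<^sup>2" using assms by (metis abs_ge_zero power2_abs power_mono)
  then show \<Delta>: "P * (4 * R - P) \<le> 4 * P * R - Q\<^sup>2" by (simp add: algebra_simps power2_eq_square)
  have "(P - 1) * (4 * R - P - 1) \<ge> 0" using assms by (intro mult_nonneg_nonneg) auto
  then show "4 * R - 1 \<le> 4 * P * R - Q\<^sup>2" using Q by (simp add: algebra_simps power2_eq_square)
  have "4 * P * (P * t\<^sup>2 - Q * t + R) = (2 * P * t - Q)\<^sup>2 + (4 * P * R - Q\<^sup>2)" by algebra
  then have "P * (4 * R - P) \<le> P * (4 * (P * t\<^sup>2 - Q * t + R))"
    using \<Delta> zero_le_power2[of "2 * P * t - Q"] by linarith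
  then show "4 * R - P \<le> 4 * (P * t\<^sup>2 - Q * t + R)" using assms by simp
qed

text \<open>
  The estimates above bound minus the discriminant below by \<open>(4 R - 1)\<^sup>3 / 16\<close>, which exceeds \<open>23\<close> from
  \<open>R = 1021 / 500\<close> on. This threshold is small enough for the estimates that assume \<open>R \<le> 1021 / 500\<close>.
\<close>

lemma disc_lower_bound_of_large_last_coefficient:
  fixes P Q R t :: real
  assumes "1 \<le> P" "\<bar>Q\<bar> \<le> P" "P \<le> R" "1021 / 500 \<le> R"
  shows "23 \<le> (4 * P * R - Q\<^sup>2) * (P * t\<^sup>2 - Q * t + R)\<^sup>2"
proof -
  define \<Delta> N where "\<Delta> = 4 * P * R - Q\<^sup>2" and "N = P * t\<^sup>2 - Q * t + R"
  have \<Delta>: "P * (4 * R - P) \<le> \<Delta>" and N: "4 * R - P \<le> 4 * N"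
    using reduced_form_bounds[OF assms(1-3)] by (simp_all add: \<Delta>_def N_def)
  \<comment> \<open>\<open>P * (4 * R - P) ^ 3\<close> increases in \<open>P\<close> on \<open>{1..R}\<close>\<close>
  define \<beta> e where "\<beta> = R - P" and "e = P - 1"
  have be: "0 \<le> \<beta>" "0 \<le> e" using assms by (auto simp: \<beta>_def e_def)
  define w where "w = 4 * R - P"
  have w: "w > 0" using assms by (simp add: w_def)
  have "368 \<le> (4 * 1021 / 500 - 1 :: real) ^ 3" by (simp add: power3_eq_cube)
  also have "\<dots> \<le> (4 * R - 1) ^ 3" using assms by (intro power_mono) auto
  also have "\<dots> \<le> P * (4 * R - P) ^ 3"
  proof -
    have w3: "w = 3 + 3 * e + 4 * \<beta>" by (simp add: w_def e_def \<beta>_def)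
    have "P * (4 * R - P) ^ 3 - (4 * R - 1) ^ 3 = e * (w * (w * (w - 3 - 3 * e) + 3 * e * (w - 1)) - e\<^sup>2)"
      unfolding w_def e_def by algebra
    moreover have "3 * (3 * e * e) \<le> w * (w * (w - 3 - 3 * e) + 3 * e * (w - 1))"
    proof (rule mult_mono)
      have "0 \<le> w * (w - 3 - 3 * e)" using w w3 be by simp
      moreover have "3 * e * e \<le> 3 * e * (w - 1)" using w3 be by (intro mult_left_mono) auto
      ultimately show "3 * e * e \<le> w * (w - 3 - 3 * e) + 3 * e * (w - 1)" by simp
    qed (use w3 be in auto)
    moreover have "e\<^sup>2 \<le> 3 * (3 * e * e)" by (simp add: power2_eq_square)
    ultimately show ?thesis using be by (smt (verit) mult_nonneg_nonneg)
  qed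
  also have "\<dots> = P * (4 * R - P) * (4 * R - P)\<^sup>2" by algebra
  also have "\<dots> \<le> \<Delta> * (4 * N)\<^sup>2"
    using order_trans[OF _ \<Delta>, of 0] \<Delta> N w assms by (intro mult_mono power_mono) (auto simp: w_def)
  also have "\<dots> = 16 * (\<Delta> * N\<^sup>2)" by algebra
  finally have "23 \<le> \<Delta> * N\<^sup>2" by simp
  then show ?thesis unfolding \<Delta>_def N_def .
qed

lemma disc_lower_bound_of_large_root:
  fixes P Q R t :: real
  assumes "1 \<le> P" "\<bar>Q\<bar> \<le> P" "P \<le> R" "R \<le> 1021 / 500" "1 < t" "1 \<le> (t - 1) * (P - Q + R)"
  shows "23 \<le> (4 * P * R - Q\<^sup>2) * (P * t\<^sup>2 - Q * t + R)\<^sup>2"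
proof -
  define \<sigma> u \<rho> where "\<sigma> = P - Q + R" and "u = t - 1" and "\<rho> = R - 1"
  have \<sigma>: "\<sigma> \<ge> R" "\<sigma> \<ge> 1" and u0: "u > 0" and \<rho>: "0 \<le> \<rho>" "\<rho> \<le> 521 / 500"
    using assms by (auto simp: \<sigma>_def u_def \<rho>_def)
  have u: "1 / \<sigma> \<le> u" using assms(6) \<sigma> by (simp add: \<sigma>_def u_def field_simps)
  have \<Delta>: "3 + 4 * \<rho> \<le> 4 * P * R - Q\<^sup>2"
    using reduced_form_bounds(2)[OF assms(1-3)] by (simp add: \<rho>_def)
  \<comment> \<open>\<open>P * t\<^sup>2 - Q * t + R\<close> is expanded at \<open>t = 1\<close>, and \<open>t - 1 \<ge> 1 / \<sigma>\<close>\<close>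
  have "\<sigma> + 1 - \<rho> / \<sigma> + 1 / \<sigma>\<^sup>2 \<le> \<sigma> + 1 + (P - R) / \<sigma> + P / \<sigma>\<^sup>2"
    using assms \<sigma> by (intro add_mono) (auto simp: \<rho>_def divide_right_mono field_simps)
  also have "\<dots> = \<sigma> + (2 * P - Q) * (1 / \<sigma>) + P * (1 / \<sigma>)\<^sup>2"
    using \<sigma> by (simp add: \<sigma>_def field_simps power2_eq_square)
  also have "\<dots> \<le> \<sigma> + (2 * P - Q) * u + P * u\<^sup>2"
    using assms u \<sigma> by (intro add_mono mult_left_mono power_mono) auto
  also have "\<dots> = P * t\<^sup>2 - Q * t + R" unfolding \<sigma>_def u_def by algebra
  finally have "\<sigma> + 1 - \<rho> / \<sigma> + 1 / \<sigma>\<^sup>2 \<le> P * t\<^sup>2 - Q * t + R" .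
  moreover have "\<rho> / \<sigma> \<le> \<rho>" using \<sigma> \<rho> by (simp add: divide_le_eq mult_le_cancel_left1)
  moreover have "47 / 25 \<le> \<sigma> + 1 / \<sigma>\<^sup>2"
  proof -
    \<comment> \<open>the minimum is at \<open>\<sigma> = root 3 2\<close>, approximately \<open>1.26\<close>\<close>
    have "0 \<le> (\<sigma> - 1.26)\<^sup>2 * (\<sigma> + 0.64) + 0.0252 * (\<sigma> - 1) + 0.009136"
      using \<sigma> by (intro add_nonneg_nonneg mult_nonneg_nonneg) auto
    also have "\<dots> = \<sigma> ^ 3 + 1 - 47 / 25 * \<sigma>\<^sup>2"
      by (simp add: power2_eq_square power3_eq_cube field_simps)
    finally have "47 / 25 * \<sigma>\<^sup>2 \<le> \<sigma> ^ 3 + 1" by simp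
    then show ?thesis using \<sigma> by (simp add: field_simps power2_eq_square power3_eq_cube)
  qed
  ultimately have N: "72 / 25 - \<rho> \<le> P * t\<^sup>2 - Q * t + R" by linarith
  have "23 \<le> (3 + 4 * \<rho>) * (72 / 25 - \<rho>)\<^sup>2"
  proof -
    have "(3 + 4 * \<rho>) * (72 / 25 - \<rho>)\<^sup>2 - 23 = 1.8832 + 15.8976 * \<rho> - 20.04 * \<rho>\<^sup>2 + 4 * \<rho> ^ 3"
      by (simp add: power2_eq_square power3_eq_cube field_simps)
    also have "\<dots> = 4 * \<rho> * (\<rho> - 0.9)\<^sup>2 + 12.84 * \<rho> * (521 / 500 - \<rho>) + (1.8832 - 0.72168 * \<rho>)"
      by (simp add: power2_eq_square power3_eq_cube field_simps)
    also have "\<dots> \<ge> 0"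
      using \<rho> by (intro add_nonneg_nonneg mult_nonneg_nonneg) auto
    finally show ?thesis by simp
  qed
  also have "\<dots> \<le> (4 * P * R - Q\<^sup>2) * (P * t\<^sup>2 - Q * t + R)\<^sup>2"
    using \<Delta> N \<rho> by (intro mult_mono power_mono) auto
  finally show ?thesis .
qed

text \<open>
  The form is \<open>f = x\<^sup>3 + b x\<^sup>2 y + c x y\<^sup>2 + d y\<^sup>3\<close>. Besides the bounds on \<open>b\<close> and the upper bound on \<open>d\<close>,
  the hypotheses are \<open>f(0, 1) \<ge> 1\<close>, \<open>f(1, -1) \<ge> 1\<close> and \<open>f(1, -2) \<le> -1\<close>. Equality holds for
  \<open>x\<^sup>3 + x\<^sup>2 y + 2 x y\<^sup>2 + y\<^sup>3\<close>, which is equivalent to \<open>x\<^sup>3 - x y\<^sup>2 - y\<^sup>3\<close>.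
\<close>

lemma monic_disc_upper_bound:
  fixes b c d :: real
  assumes b: "- 1 / 2 \<le> b" "b \<le> 2" and d: "1 \<le> d" "d \<le> 3"
    and c: "b + d \<le> c" "2 * c \<le> 4 * d + b - 1"
  shows "cubic_disc 1 b c d \<le> - 23"
proof -
  define H where "H = (\<lambda>d. - cubic_disc 1 b (b + d) d)"
  \<comment> \<open>\<open>- cubic_disc 1 b c d\<close> increases in \<open>c\<close> from \<open>c = b + d\<close> on\<close>
  have c_min: "H d \<le> - cubic_disc 1 b c d"
  proof -
    define z where "z = c - (b + d)"
    have z: "0 \<le> z" using c by (simp add: z_def)
    have "- cubic_disc 1 b c d - H d
      = z * (2 * b\<^sup>2 * (6 - b - d) + 6 * d * (b + 2 * d) + z * (12 * (b + d) - b\<^sup>2) + 4 * z\<^sup>2)"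
      unfolding cubic_disc_def H_def z_def power_one mult_1 mult_1_right by algebra
    moreover have "0 \<le> 12 * (b + d) - b\<^sup>2"
    proof -
      have "(b + 1 / 2) * (2 - b) \<ge> 0" using b by simp
      then have "2 * b\<^sup>2 \<le> 3 * b + 2" by (simp add: power2_eq_square field_simps)
      moreover have "3 * b + 2 \<le> 2 * (12 * (b + d))" using b d by simp
      ultimately show ?thesis by simp
    qed
    ultimately show ?thesis using z b d
      by (smt (verit) mult_nonneg_nonneg zero_le_power2)
  qed
  have d_min: "H d0 \<le> H d" if "1 \<le> d0" "d0 \<le> d" for d0
  proof -
    define U V W where "U = d\<^sup>2 + d * d0 + d0\<^sup>2" and "V = (27 - 6 * b - b\<^sup>2) * (d + d0)"
      and "W = b\<^sup>2 * (3 - b)"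
    have "H d - H d0 = (d - d0) * (4 * U + V - 2 * W)"
      unfolding cubic_disc_def H_def U_def V_def W_def power_one mult_1 mult_1_right by algebra
    moreover have b2: "b\<^sup>2 \<le> 4" using b power_mono[of "\<bar>b\<bar>" 2 2] by auto
    moreover have "W \<le> 4 * (7 / 2)" unfolding W_def using b b2 by (intro mult_mono) auto
    moreover have "1 \<le> d\<^sup>2" "1 \<le> d * d0" "1 \<le> d0\<^sup>2"
      using that mult_mono[of 1 d 1 d0] by simp_all
    then have "3 \<le> U" unfolding U_def by linarith
    moreover have "11 * 2 \<le> V"
      unfolding V_def using b b2 that by (intro mult_mono) auto
    ultimately show ?thesis
      using that mult_nonneg_nonneg[of "d - d0" "4 * U + V - 2 * W"] by linarith
  qed
  \<comment> \<open>the bounds on \<open>c\<close> imply \<open>d \<ge> (b + 1) / 2\<close>, so the least admissible \<open>d\<close> is the larger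
    of \<open>1\<close> and \<open>(b + 1) / 2\<close>\<close>
  show ?thesis
  proof (cases "b \<le> 1")
    case True
    define y where "y = 1 - b"
    have y: "0 \<le> y" "y \<le> 3/2" using True b by (auto simp: y_def)
    have "H 1 = 23 + y * (6 + 5 * y - 2 * y\<^sup>2 - y ^ 3)"
      unfolding cubic_disc_def H_def y_def power_one mult_1 mult_1_right by algebra
    moreover have "6 + 5 * y - 2 * y\<^sup>2 - y ^ 3 \<ge> 0"
    proof -
      have "y\<^sup>2 \<le> 3 / 2 * y" "y ^ 3 \<le> (3 / 2)\<^sup>2 * y"
        using y mult_right_mono[of y "3 / 2" y] mult_right_mono[of "y\<^sup>2" "(3 / 2)\<^sup>2" y] power_mono[of y "3 / 2" 2]
        by (simp_all add: power2_eq_square power3_eq_cube)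
      then show ?thesis using y by (simp add: power2_eq_square)
    qed
    ultimately have "H 1 \<ge> 23" using y by simp
    then show ?thesis using d_min[of 1] c_min d by simp
  next
    case False
    define x where "x = (b - 1) / 2"
    have x: "0 \<le> x" "x \<le> 1/2" using False b by (auto simp: x_def)
    have "b = 1 + 2 * x" by (simp add: x_def field_simps)
    then have "H (1 + x) = 23 + x * (36 + 8 * x - 4 * x\<^sup>2 - 4 * x ^ 3)"
      unfolding cubic_disc_def H_def power_one mult_1 mult_1_right by algebra
    moreover have "36 + 8 * x - 4 * x\<^sup>2 - 4 * x ^ 3 \<ge> 0"
      using x power_le_one[of x 2] power_le_one[of x 3] by linarith
    ultimately have "H (1 + x) \<ge> 23" using x by simp
    moreover have "1 + x \<le> d" using c by (simp add: x_def field_simps)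
    ultimately show ?thesis using d_min[of "1 + x"] c_min x by simp
  qed
qed

lemma disc_lower_bound_of_medium_root:
  fixes P Q R t :: real
  assumes PQR: "1 \<le> P" "\<bar>Q\<bar> \<le> P" "P \<le> R" "R \<le> 1021 / 500" and t: "1 / 2 \<le> t" "t \<le> 1" "1 \<le> t * R"
    and s: "1 \<le> (1 - t) * (P - Q + R)" and r: "1 \<le> (2 * t - 1) * (P - 2 * Q + 4 * R)"
  shows "23 \<le> (4 * P * R - Q\<^sup>2) * (P * t\<^sup>2 - Q * t + R)\<^sup>2"
proof (cases "Q < P - 2")
  \<comment> \<open>here the reduction to \<open>P = 1\<close> would move \<open>Q\<close> below \<open>-1\<close>\<close>
  case True
  then have w: "2 \<le> P - Q" by simp
  have R: "1 \<le> R" using PQR by simp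
  note bounds = reduced_form_bounds[OF PQR(1-3)]
  show ?thesis
  proof (cases "Q \<le> 0")
    case True
    have "Q * t * (1 - t) \<le> 0" using True t by (simp add: mult_nonpos_nonneg)
    moreover have "2 * t\<^sup>2 \<le> (P - Q) * t\<^sup>2" using w by (intro mult_right_mono) auto
    ultimately have N: "2 * t\<^sup>2 + R \<le> P * t\<^sup>2 - Q * t + R"
      by (simp add: algebra_simps power2_eq_square)
    have "1 \<le> (t * R)\<^sup>2" using t by simp
    then have "R ^ 3 + 2 \<le> (2 * t\<^sup>2 + R) * R\<^sup>2"
      by (simp add: power2_eq_square power3_eq_cube algebra_simps)
    also have "\<dots> \<le> (P * t\<^sup>2 - Q * t + R) * R\<^sup>2" using N by (intro mult_right_mono) auto
    finally have N': "R ^ 3 + 2 \<le> (P * t\<^sup>2 - Q * t + R) * R\<^sup>2" .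
    define e where "e = R - 1"
    have "(4 * R - 1) * (R ^ 3 + 2)\<^sup>2 - 23 * R ^ 4
        = 4 - 2 * e + 15 * e\<^sup>2 + e ^ 3 * (88 + 118 * e + 78 * e\<^sup>2 + 27 * e ^ 3 + 4 * e ^ 4)"
      unfolding e_def by algebra
    moreover have "4 - 2 * e + 15 * e\<^sup>2 = 3 + 14 * e\<^sup>2 + (1 - e)\<^sup>2" by algebra
    moreover have "0 \<le> e" using R by (simp add: e_def)
    then have "0 \<le> 3 + 14 * e\<^sup>2 + (1 - e)\<^sup>2
        + e ^ 3 * (88 + 118 * e + 78 * e\<^sup>2 + 27 * e ^ 3 + 4 * e ^ 4)"
      by (intro add_nonneg_nonneg mult_nonneg_nonneg) auto
    ultimately have "23 * R ^ 4 \<le> (4 * R - 1) * (R ^ 3 + 2)\<^sup>2" by linarith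
    also have "\<dots> \<le> (4 * P * R - Q\<^sup>2) * ((P * t\<^sup>2 - Q * t + R) * R\<^sup>2)\<^sup>2"
      using bounds(2) N' R by (intro mult_mono power_mono) auto
    also have "\<dots> = (4 * P * R - Q\<^sup>2) * (P * t\<^sup>2 - Q * t + R)\<^sup>2 * R ^ 4" by algebra
    finally show ?thesis using R by simp
  next
    case False
    then have P: "2 \<le> P" using w by simp
    then have "2 * 6 \<le> P * (4 * R - P)" using PQR by (intro mult_mono) auto
    then have "12 \<le> 4 * P * R - Q\<^sup>2" using bounds(1) by simp
    moreover have "3 / 2 \<le> P * t\<^sup>2 - Q * t + R" using bounds(3)[of t] P PQR by simp
    ultimately have "12 * (3 / 2)\<^sup>2 \<le> (4 * P * R - Q\<^sup>2) * (P * t\<^sup>2 - Q * t + R)\<^sup>2"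
      by (intro mult_mono power_mono) auto
    then show ?thesis by (simp add: power2_eq_square)
  qed
next
  case False
  define q where "q = Q - (P - 1)"
  define b c d where "b = q + t" and "c = R + t * q" and "d = t * R"
  have q: "- 1 \<le> q" "q \<le> 1" using False PQR by (auto simp: q_def)
  have "0 \<le> (2 * t - 1) * (P - 1)" using PQR t by simp
  then have r': "1 \<le> (2 * t - 1) * (1 - 2 * q + 4 * R)"
    using r by (simp add: q_def algebra_simps)
  have s': "1 \<le> (1 - t) * (1 - q + R)" using s by (simp add: q_def)
  have "t * R \<le> R" using t PQR by (simp add: mult_left_le_one_le)
  then have d: "1 \<le> d" "d \<le> 3" using t PQR unfolding d_def by linarith+
  have "cubic_disc 1 b c d \<le> - 23"
  proof (rule monic_disc_upper_bound)
    show "b + d \<le> c" using s' by (simp add: b_def c_def d_def algebra_simps)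
    show "2 * c \<le> 4 * d + b - 1" using r' by (simp add: b_def c_def d_def algebra_simps)
  qed (use q t d in \<open>auto simp: b_def\<close>)
  moreover have "cubic_disc 1 b c d = - ((4 * 1 * R - q\<^sup>2) * (1 * t\<^sup>2 - q * t * 1 + R * 1\<^sup>2)\<^sup>2)"
    using cubic_disc_factored[of 1 1 q t R] by (simp add: b_def c_def d_def algebra_simps)
  ultimately have "23 \<le> (4 * (P - (P - 1)) * R - (Q - (P - 1))\<^sup>2)
    * ((P - (P - 1)) * t\<^sup>2 - (Q - (P - 1)) * t + R)\<^sup>2"
    by (simp add: q_def)
  also have "\<dots> \<le> (4 * P * R - Q\<^sup>2) * (P * t\<^sup>2 - Q * t + R)\<^sup>2"
    using PQR t by (intro factored_disc_mono) auto
  finally show ?thesis .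
qed

text \<open>
  The four hypotheses on \<open>P\<close>, \<open>t * R\<close>, \<open>1 - t\<close> and \<open>1 - 2 t\<close> state that
  \<open>(x + t y) (P x\<^sup>2 + Q x y + R y\<^sup>2)\<close> has absolute value at least \<open>1\<close> at \<open>(1, 0)\<close>, \<open>(0, 1)\<close>,
  \<open>(1, -1)\<close> and \<open>(1, -2)\<close>. For small \<open>R\<close> they exclude \<open>t < 1 / 2\<close>.
\<close>

lemma disc_lower_bound_of_positive_root:
  fixes P Q R t :: real
  assumes PQR: "1 \<le> P" "\<bar>Q\<bar> \<le> P" "P \<le> R" and t: "0 < t" "1 \<le> t * R"
    and s: "1 \<le> \<bar>1 - t\<bar> * (P - Q + R)" and r: "1 \<le> \<bar>1 - 2 * t\<bar> * (P - 2 * Q + 4 * R)"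
  shows "23 \<le> (4 * P * R - Q\<^sup>2) * (P * t\<^sup>2 - Q * t + R)\<^sup>2"
proof -
  consider "1021 / 500 \<le> R" | "R \<le> 1021 / 500" "1 < t" | "R \<le> 1021 / 500" "t \<le> 1" by linarith
  then show ?thesis
  proof cases
    case 1
    then show ?thesis by (intro disc_lower_bound_of_large_last_coefficient PQR)
  next
    case 2
    then show ?thesis using s by (intro disc_lower_bound_of_large_root PQR) auto
  next
    case 3
    have "1 / 2 \<le> t"
    proof (rule ccontr)
      assume neg: "\<not> 1 / 2 \<le> t"
      then have "1 \<le> (1 - 2 * t) * (P - 2 * Q + 4 * R)" using r by simp
      also have "\<dots> \<le> (1 - 2 * t) * (7 * R)" using neg PQR by (intro mult_left_mono) auto
      also have "\<dots> = 7 * R - 14 * (t * R)" by (simp add: algebra_simps)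
      finally show False using t 3 by simp
    qed
    then show ?thesis using 3 t s r by (intro disc_lower_bound_of_medium_root PQR) auto
  qed
qed

text \<open>\<open>\<bar>f\<bar> \<ge> 1\<close> at all nonzero integer points.\<close>

definition integer_form_bound :: "(real \<Rightarrow> real \<Rightarrow> real) \<Rightarrow> bool" where
  "integer_form_bound f \<longleftrightarrow>
    (\<forall>x y :: int. (x, y) \<noteq> (0, 0) \<longrightarrow> 1 \<le> \<bar>f (of_int x) (of_int y)\<bar>)"

lemma disc_lower_bound_reduced:
  fixes \<theta> \<phi> P Q R :: real
  assumes PQR: "0 < P" "\<bar>Q\<bar> \<le> P" "P \<le> R"
    and f: "integer_form_bound (\<lambda>x y. (\<theta> * x + \<phi> * y) * qform P Q R x y)"
  shows "23 \<le> (4 * P * R - Q\<^sup>2) * (P * \<phi>\<^sup>2 - Q * \<phi> * \<theta> + R * \<theta>\<^sup>2)\<^sup>2"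
proof -
  have val: "1 \<le> \<bar>\<theta> * x + \<phi> * y\<bar> * (P * x\<^sup>2 + Q * x * y + R * y\<^sup>2)"
    if xy: "x \<in> \<int>" "y \<in> \<int>" "(x, y) \<noteq> (0, 0)" for x y :: real
  proof -
    have "Q\<^sup>2 \<le> P\<^sup>2" using PQR by (metis abs_ge_zero power2_abs power_mono)
    also have "\<dots> < 4 * P * R" using PQR by (simp add: power2_eq_square)
    finally have "0 < qform P Q R x y" using PQR xy by (intro qform_pos) auto
    then have "\<bar>\<theta> * x + \<phi> * y\<bar> * qform P Q R x y = \<bar>(\<theta> * x + \<phi> * y) * qform P Q R x y\<bar>"
      by (simp add: abs_mult)
    moreover obtain m n where "x = of_int m" "y = of_int n" using xy by (auto elim!: Ints_cases)
    ultimately show ?thesis using f xy unfolding integer_form_bound_def qform_def by auto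
  qed
  have 10: "1 \<le> \<bar>\<theta>\<bar> * P" and 01: "1 \<le> \<bar>\<phi>\<bar> * R" using val[of 1 0] val[of 0 1] by auto
  then have \<theta>: "\<theta> \<noteq> 0" and \<phi>: "\<phi> \<noteq> 0" by auto
  \<comment> \<open>moving the factor \<open>\<bar>\<theta>\<bar>\<close> to the quadratic form and replacing \<open>y\<close> by \<open>\<epsilon> * y\<close> turns the linear
    factor into \<open>x + t * y\<close> with \<open>t > 0\<close>, up to sign\<close>
  define \<epsilon> where "\<epsilon> = sgn (\<theta> * \<phi>)"
  have \<epsilon>: "\<epsilon> = 1 \<or> \<epsilon> = - 1" using \<theta> \<phi> by (auto simp: \<epsilon>_def sgn_if)
  define k t where "k = \<bar>\<theta>\<bar>" and "t = \<bar>\<phi> / \<theta>\<bar>"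
  have t: "t > 0" "\<phi> = \<epsilon> * t * \<theta>" and k: "k > 0" "k\<^sup>2 = \<theta>\<^sup>2" using \<theta> \<phi>
    by (auto simp: t_def \<epsilon>_def k_def sgn_if abs_if zero_less_mult_iff divide_simps mult_less_0_iff)
  have kt: "\<bar>\<theta> * 1 + \<phi> * (- \<epsilon> * j)\<bar> = k * \<bar>1 - j * t\<bar>" for j
    using \<epsilon> by (auto simp: t(2) k_def simp flip: abs_mult) (simp_all add: algebra_simps)
  have "23 \<le> (4 * (k * P) * (k * R) - (k * (\<epsilon> * Q))\<^sup>2)
    * (k * P * t\<^sup>2 - k * (\<epsilon> * Q) * t + k * R)\<^sup>2"
  proof (rule disc_lower_bound_of_positive_root)
    show "1 \<le> k * P" using 10 by (simp add: k_def)
    show "\<bar>k * (\<epsilon> * Q)\<bar> \<le> k * P" using \<epsilon> PQR k by (auto simp: abs_mult)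
    show "k * P \<le> k * R" using k PQR by simp
    show "1 \<le> t * (k * R)" using 01 \<theta> by (simp add: t_def k_def abs_divide)
    show "1 \<le> \<bar>1 - t\<bar> * (k * P - k * (\<epsilon> * Q) + k * R)"
      using val[of 1 "- \<epsilon>"] \<epsilon> kt[of 1] by (auto simp: algebra_simps)
    show "1 \<le> \<bar>1 - 2 * t\<bar> * (k * P - 2 * (k * (\<epsilon> * Q)) + 4 * (k * R))"
      using val[of 1 "- \<epsilon> * 2"] \<epsilon> kt[of 2] by (auto simp: algebra_simps)
  qed (fact t)
  also have "\<dots> = (4 * P * R - \<epsilon>\<^sup>2 * Q\<^sup>2) * (P * t\<^sup>2 - \<epsilon> * Q * t + R)\<^sup>2 * (k\<^sup>2)\<^sup>2" by algebra
  also have "\<dots> = (4 * P * R - \<epsilon>\<^sup>2 * Q\<^sup>2) * (P * t\<^sup>2 * \<theta>\<^sup>2 - \<epsilon> * Q * t * \<theta>\<^sup>2 + R * \<theta>\<^sup>2)\<^sup>2"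
    unfolding k by algebra
  also have "\<dots> = (4 * P * R - Q\<^sup>2) * (P * \<phi>\<^sup>2 - Q * \<phi> * \<theta> + R * \<theta>\<^sup>2)\<^sup>2"
    using \<epsilon> unfolding t(2) by (auto simp: power2_eq_square algebra_simps)
  finally show ?thesis .
qed

section \<open>The minimum of a cubic form\<close>

theorem cubic_disc_upper_bound:
  assumes D: "cubic_disc a b c d < 0" and f: "integer_form_bound (cubic a b c d)"
  shows "cubic_disc a b c d \<le> - 23"
proof -
  obtain \<theta> \<phi> P Q R where PQR: "P > 0" "4 * P * R - Q\<^sup>2 > 0"
    and abcd: "a = \<theta> * P" "b = \<theta> * Q + \<phi> * P" "c = \<theta> * R + \<phi> * Q" "d = \<phi> * R"
    by (rule cubic_factorization[OF D])
  obtain m n k l :: int where det: "\<bar>m * l - n * k\<bar> = 1"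
    and red: "\<bar>qpolar P Q R m n k l\<bar> \<le> qform P Q R m n"
      "qform P Q R m n \<le> qform P Q R k l"
    by (rule qform_reduced_basis[OF PQR])
  have mn: "(m, n) \<noteq> (0, 0)" using det by auto
  have "23 \<le> (4 * qform P Q R m n * qform P Q R k l - (qpolar P Q R m n k l)\<^sup>2) *
    (qform P Q R m n * (\<theta> * k + \<phi> * l)\<^sup>2
      - qpolar P Q R m n k l * (\<theta> * k + \<phi> * l) * (\<theta> * m + \<phi> * n)
      + qform P Q R k l * (\<theta> * m + \<phi> * n)\<^sup>2)\<^sup>2"
  proof (rule disc_lower_bound_reduced)
    show "0 < qform P Q R m n" using PQR mn by (intro qform_pos) auto
    show "\<bar>qpolar P Q R m n k l\<bar> \<le> qform P Q R m n" "qform P Q R m n \<le> qform P Q R k l"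
      using red by simp_all
    show "integer_form_bound (\<lambda>x y. ((\<theta> * m + \<phi> * n) * x + (\<theta> * k + \<phi> * l) * y)
      * qform (qform P Q R m n) (qpolar P Q R m n k l) (qform P Q R k l) x y)"
      unfolding integer_form_bound_def
    proof (intro allI impI)
      fix x y :: int
      assume xy: "(x, y) \<noteq> (0, 0)"
      have "(m * x + k * y, n * x + l * y) \<noteq> (0, 0)"
      proof
        assume z: "(m * x + k * y, n * x + l * y) = (0, 0)"
        have "(m * l - n * k) * x = l * (m * x + k * y) - k * (n * x + l * y)"
          "(m * l - n * k) * y = m * (n * x + l * y) - n * (m * x + k * y)" by algebra+
        with z have "(m * l - n * k) * x = 0" "(m * l - n * k) * y = 0" by auto
        with det xy show False by auto
      qed
      then have "1 \<le> \<bar>cubic a b c d (of_int (m * x + k * y)) (of_int (n * x + l * y))\<bar>"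
        using f unfolding integer_form_bound_def by blast
      then show "1 \<le> \<bar>((\<theta> * m + \<phi> * n) * x + (\<theta> * k + \<phi> * l) * y)
          * qform (qform P Q R m n) (qpolar P Q R m n k l) (qform P Q R k l) x y\<bar>"
        unfolding abcd cubic_factored of_int_add of_int_mult qform_substitution
        by (simp add: algebra_simps)
    qed
  qed
  also have "\<dots> = (real_of_int m * l - real_of_int k * n) ^ 6
      * ((4 * P * R - Q\<^sup>2) * (P * \<phi>\<^sup>2 - Q * \<phi> * \<theta> + R * \<theta>\<^sup>2)\<^sup>2)"
    unfolding qform_disc_substitution qform_root_substitution
    by (simp add: power_mult_distrib flip: power_mult power_add)
  also have "(real_of_int m * l - real_of_int k * n) ^ 6 = 1"
  proof -
    have "(m * l - k * n) ^ 6 = 1"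
      using det by (metis even_numeral mult.commute power_even_abs power_one)
    then have "real_of_int ((m * l - k * n) ^ 6) = 1" by simp
    then show ?thesis by simp
  qed
  finally show ?thesis unfolding abcd cubic_disc_factored by simp
qed

section \<open>Forms with prescribed minimum\<close>

text \<open>Modulo 2 the form vanishes only at \<open>(0, 0)\<close>; hence infinite descent.\<close>

lemma plastic_form_nonzero:
  fixes x y :: int
  assumes "(x, y) \<noteq> (0, 0)"
  shows "x ^ 3 - x * y\<^sup>2 - y ^ 3 \<noteq> 0"
  using assms
proof (induction "nat (\<bar>x\<bar> + \<bar>y\<bar>)" arbitrary: x y rule: less_induct)
  case less
  show ?case
  proof
    assume z: "x ^ 3 - x * y\<^sup>2 - y ^ 3 = 0"
    then have "even (x ^ 3 - x * y\<^sup>2 - y ^ 3)" by simp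
    then have "even x" "even y" by auto
    then obtain u v where uv: "x = 2 * u" "y = 2 * v" by (auto elim!: evenE)
    have "8 * (u ^ 3 - u * v\<^sup>2 - v ^ 3) = 0" using z unfolding uv by (simp add: power_mult_distrib)
    moreover have "(u, v) \<noteq> (0, 0)" using less.prems uv by auto
    moreover have "nat (\<bar>u\<bar> + \<bar>v\<bar>) < nat (\<bar>x\<bar> + \<bar>y\<bar>)" using \<open>(u, v) \<noteq> (0, 0)\<close> uv by auto
    ultimately show False using less.hyps[of u v] by simp
  qed
qed

lemma cubic_with_minimum_one:
  assumes "D \<le> - 23"
  obtains a b c d where "cubic_disc a b c d = D" "integer_form_bound (cubic a b c d)" "cubic a b c d 1 0 = 1"
proof -
  \<comment> \<open>\<open>\<theta> \<ge> 6 / 5\<close> ensures that the quadratic cofactor \<open>x\<^sup>2 + \<theta> x y + (\<theta>\<^sup>2 - 1) y\<^sup>2\<close> is positive definite\<close>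
  have "\<exists>s\<ge>6/5. s \<le> 2 \<and> s ^ 3 - s - 1 = (0 :: real)"
    by (intro IVT') (auto intro!: continuous_intros simp: power3_eq_cube)
  then obtain \<theta> :: real where \<theta>: "6 / 5 \<le> \<theta>" "\<theta> ^ 3 = \<theta> + 1" by auto
  define disc where "disc = (\<lambda>u. cubic_disc 1 0 (u - 1) (- (1 + u * \<theta>)))"
  have disc: "disc u = - 4 * (u - 1) ^ 3 - 27 * (1 + u * \<theta>)\<^sup>2" for u
    by (simp add: disc_def cubic_disc_def power2_eq_square algebra_simps)
  have "- disc (- D) \<ge> - D"
  proof -
    have "1 \<le> \<theta>" using \<theta> by simp
    then have "- D * 1 \<le> - D * \<theta>" using assms by (intro mult_left_mono) auto
    then have "- D \<le> 1 + - D * \<theta>" by linarith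
    then have "(- D)\<^sup>2 \<le> (1 + - D * \<theta>)\<^sup>2" using assms by (intro power_mono) auto
    moreover have "- D * 1 \<le> (- D) * (- D)" using assms by (intro mult_left_mono) auto
    moreover have "0 \<le> (- D - 1) ^ 3" using assms by (intro zero_le_power) auto
    ultimately show ?thesis unfolding disc power2_eq_square[of "- D"] using assms by linarith
  qed
  then have "\<exists>u\<ge>0. u \<le> - D \<and> - disc u = - D"
    using assms by (intro IVT') (auto simp: disc intro!: continuous_intros)
  then obtain u where u: "0 \<le> u" "disc u = D" by auto
  have "integer_form_bound (cubic 1 0 (u - 1) (- (1 + u * \<theta>)))"
    unfolding integer_form_bound_def
  proof (intro allI impI)
    fix x y :: int
    assume xy: "(x, y) \<noteq> (0, 0)"
    let ?x = "real_of_int x" and ?y = "real_of_int y"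
    define q where "q = ?x\<^sup>2 + \<theta> * ?x * ?y + (\<theta>\<^sup>2 - 1) * ?y\<^sup>2"
    have "(6 / 5)\<^sup>2 \<le> \<theta>\<^sup>2" using \<theta> by (intro power_mono) auto
    then have "0 \<le> (?x + \<theta> / 2 * ?y)\<^sup>2 + (3 / 4 * \<theta>\<^sup>2 - 1) * ?y\<^sup>2" by (simp add: power2_eq_square)
    also have "\<dots> = q" by (simp add: q_def field_simps power2_eq_square)
    finally have q: "0 \<le> q" .
    have "x ^ 3 - x * y\<^sup>2 - y ^ 3 \<noteq> 0" using xy by (rule plastic_form_nonzero)
    then have "1 \<le> \<bar>x ^ 3 - x * y\<^sup>2 - y ^ 3\<bar>" by simp
    then have "1 \<le> \<bar>real_of_int (x ^ 3 - x * y\<^sup>2 - y ^ 3)\<bar>" by linarith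
    also have "real_of_int (x ^ 3 - x * y\<^sup>2 - y ^ 3) = (?x - \<theta> * ?y) * q"
    proof -
      have "(?x - \<theta> * ?y) * q = ?x ^ 3 - ?x * ?y\<^sup>2 + (\<theta> - \<theta> ^ 3) * ?y ^ 3"
        unfolding q_def by algebra
      then show ?thesis by (simp add: \<theta>)
    qed
    also have "\<bar>(?x - \<theta> * ?y) * q\<bar> = \<bar>?x - \<theta> * ?y\<bar> * q" using q by (simp add: abs_mult)
    also have "\<dots> \<le> \<bar>?x - \<theta> * ?y\<bar> * (q + u * ?y\<^sup>2)" using u by (intro mult_left_mono) auto
    also have "\<dots> = \<bar>(?x - \<theta> * ?y) * (q + u * ?y\<^sup>2)\<bar>" using u q by (simp add: abs_mult)
    also have "(?x - \<theta> * ?y) * (q + u * ?y\<^sup>2) = cubic 1 0 (u - 1) (- (1 + u * \<theta>)) ?x ?y"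
    proof -
      have "(?x - \<theta> * ?y) * (q + u * ?y\<^sup>2) = ?x ^ 3 + (u - 1) * ?x * ?y\<^sup>2 + (\<theta> - \<theta> ^ 3 - u * \<theta>) * ?y ^ 3"
        unfolding q_def by algebra
      then show ?thesis by (simp add: \<theta> cubic_def)
    qed
    finally show "1 \<le> \<bar>cubic 1 0 (u - 1) (- (1 + u * \<theta>)) ?x ?y\<bar>" .
  qed
  then show ?thesis using that[of 1 0 "u - 1" "- (1 + u * \<theta>)"] u by (simp add: disc_def cubic_def)
qed

section \<open>The spectrum in terms of equivalent forms\<close>

text \<open>The infimum of \<open>\<bar>f\<bar>\<close> over the nonzero integer points; it need not be attained.\<close>

definition integer_minimum :: "(real \<Rightarrow> real \<Rightarrow> real) \<Rightarrow> real" where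
  "integer_minimum f = (INF (x, y) \<in> UNIV - {(0, 0)}. \<bar>f (real_of_int x) (real_of_int y)\<bar>)"

lemma integer_minimum_bdd_below:
  "bdd_below ((\<lambda>(x, y). \<bar>f (real_of_int x) (real_of_int y) :: real\<bar>) ` A)"
  by (rule bdd_belowI[of _ 0]) auto

lemma integer_minimum_le:
  "(x, y) \<noteq> (0, 0) \<Longrightarrow> integer_minimum f \<le> \<bar>f (real_of_int x) (real_of_int y)\<bar>"
  unfolding integer_minimum_def
  by (rule order_trans[OF cINF_lower[OF integer_minimum_bdd_below, of "(x, y)"]]) auto

lemma integer_minimum_ge:
  assumes "\<And>x y :: int. (x, y) \<noteq> (0, 0) \<Longrightarrow> m \<le> \<bar>f (real_of_int x) (real_of_int y)\<bar>"
  shows "m \<le> integer_minimum f"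
proof -
  have "(1, 0) \<in> UNIV - {(0 :: int, 0 :: int)}" by simp
  then have "UNIV - {(0, 0)} \<noteq> ({} :: (int \<times> int) set)" by blast
  then show ?thesis unfolding integer_minimum_def by (rule cINF_greatest) (use assms in auto)
qed

lemma integer_minimum_nonneg: "0 \<le> integer_minimum f"
  by (rule integer_minimum_ge) simp

text \<open>Here \<open>f\<close> is the composition of \<open>F\<close> with \<open>A\<close>, written in coordinates.\<close>

lemma integer_minimum_column_lattice:
  fixes A :: "real ^ 2 ^ 2"
  assumes A: "invertible A"
    and f: "\<And>x y. F (vector [A $ 1 $ 1 * x + A $ 1 $ 2 * y, A $ 2 $ 1 * x + A $ 2 $ 2 * y]) = f x y"
  shows "(INF v\<in>column_lattice A - {0}. \<bar>F v\<bar>) = integer_minimum f"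
proof -
  define g where "g = (\<lambda>(x :: int, y :: int). A *v vector [real_of_int x, real_of_int y])"
  have g: "g (x, y) = vector [A $ 1 $ 1 * x + A $ 1 $ 2 * y, A $ 2 $ 1 * x + A $ 2 $ 2 * y]" for x y
    by (simp add: g_def vec_eq_iff forall_2 matrix_vector_mult_def sum_2)
  have inj: "A *v z = 0 \<longleftrightarrow> z = 0" for z
    using A by (metis invertible_left_inverse matrix_vector_mul_assoc matrix_vector_mul_lid matrix_vector_mult_0_right)
  have zero: "g (x, y) = 0 \<longleftrightarrow> (x, y) = (0, 0)" for x y
  proof -
    have "g (x, y) = 0 \<longleftrightarrow> (vector [real_of_int x, real_of_int y] :: real ^ 2) = 0"
      unfolding g_def prod.case by (rule inj)
    then show ?thesis by (simp add: vec_eq_iff forall_2)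
  qed
  have "column_lattice A - {0} = g ` (UNIV - {(0, 0)})"
  proof (intro equalityI subsetI)
    fix v assume v: "v \<in> column_lattice A - {0}"
    then obtain z where z: "v = A *v z" "\<forall>i. z $ i \<in> \<int>" by (auto simp: column_lattice_def)
    obtain x y where "z $ 1 = of_int x" "z $ 2 = of_int y" using z(2) by (meson Ints_cases)
    then have "z = vector [real_of_int x, real_of_int y]" by (simp add: vec_eq_iff forall_2)
    then have "v = g (x, y)" by (simp add: z g_def)
    then show "v \<in> g ` (UNIV - {(0, 0)})" using v zero by auto
  next
    fix v assume "v \<in> g ` (UNIV - {(0, 0)})"
    then obtain x y where v: "v = g (x, y)" "(x, y) \<noteq> (0, 0)" by auto
    then have "v \<in> column_lattice A" unfolding column_lattice_def
      by (auto simp: g_def forall_2 intro!: exI[of _ "vector [real_of_int x, real_of_int y]"])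
    then show "v \<in> column_lattice A - {0}" using v zero by auto
  qed
  then show ?thesis
    by (simp add: integer_minimum_def image_image g f case_prod_unfold cong: image_cong_simp)
      (metis (no_types, lifting) g f prod.collapse)
qed


lemma cubic_substitution:
  fixes p q r s :: real
  assumes "cubic_disc a b c d < 0"
  shows "\<exists>a' b' c' d'. (\<forall>x y. cubic a b c d (p * x + q * y) (r * x + s * y) = cubic a' b' c' d' x y)
    \<and> cubic_disc a' b' c' d' = (p * s - q * r) ^ 6 * cubic_disc a b c d"
proof -
  obtain \<theta> \<phi> P Q R where
    f: "a = \<theta> * P" "b = \<theta> * Q + \<phi> * P" "c = \<theta> * R + \<phi> * Q" "d = \<phi> * R"
    by (rule cubic_factorization[OF assms])
  define \<theta>' \<phi>' where "\<theta>' = \<theta> * p + \<phi> * r" and "\<phi>' = \<theta> * q + \<phi> * s"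
  define P' Q' R' where "P' = qform P Q R p r" and "Q' = qpolar P Q R p r q s"
    and "R' = qform P Q R q s"
  have "cubic a b c d (p * x + q * y) (r * x + s * y)
      = cubic (\<theta>' * P') (\<theta>' * Q' + \<phi>' * P') (\<theta>' * R' + \<phi>' * Q') (\<phi>' * R') x y" for x y
    unfolding f cubic_factored qform_substitution
    by (simp add: \<theta>'_def \<phi>'_def P'_def Q'_def R'_def algebra_simps)
  moreover have "cubic_disc (\<theta>' * P') (\<theta>' * Q' + \<phi>' * P') (\<theta>' * R' + \<phi>' * Q') (\<phi>' * R')
      = (p * s - q * r) ^ 6 * cubic_disc a b c d"
    unfolding f cubic_disc_factored \<theta>'_def \<phi>'_def P'_def Q'_def R'_def
      qform_disc_substitution qform_root_substitution
    by (simp add: power_mult_distrib flip: power_mult power_add)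
  ultimately show ?thesis by blast
qed

lemma Spec_eq_integer_minima:
  assumes P: "binary_form 3 P" and D: "cubic_discriminant P < 0"
  shows "Spec P =
    {integer_minimum (cubic a b c d) | a b c d. cubic_disc a b c d = cubic_discriminant P}"
proof -
  obtain a b c d where eval: "\<And>x y. form_eval P (vector [x, y]) = cubic a b c d x y"
    and disc: "cubic_disc a b c d = cubic_discriminant P"
    using form_eval_cubic[OF P] unfolding cubic_def cubic_disc_def cubic_discriminant_def Let_def
    by (metis vector_2)
  have neg: "cubic_disc a b c d < 0" using D by (simp add: disc)
  show ?thesis
  proof (intro equalityI subsetI)
    fix m assume "m \<in> Spec P"
    then obtain L where L: "unimodular_lattice L" "m = (INF v\<in>L - {0}. \<bar>form_eval P v\<bar>)"
      by (auto simp: Spec_def)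
    then obtain A where A: "invertible A" "L = column_lattice A"
      by (auto simp: unimodular_lattice_def is_lattice_def)
    have "\<bar>det A\<bar> = 1"
      using L(1) covolume_column_lattice[OF A(1)] by (simp add: A(2) unimodular_lattice_def)
    then have "(det A) ^ 6 = 1" by (metis even_numeral power_even_abs power_one)
    then have det: "(A $ 1 $ 1 * A $ 2 $ 2 - A $ 1 $ 2 * A $ 2 $ 1) ^ 6 = 1" by (simp add: det_2)
    obtain a' b' c' d' where sub: "\<forall>x y. cubic a b c d (A $ 1 $ 1 * x + A $ 1 $ 2 * y)
        (A $ 2 $ 1 * x + A $ 2 $ 2 * y) = cubic a' b' c' d' x y"
      "cubic_disc a' b' c' d' = (A $ 1 $ 1 * A $ 2 $ 2 - A $ 1 $ 2 * A $ 2 $ 1) ^ 6 * cubic_disc a b c d"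
      using cubic_substitution[OF neg] by blast
    have "m = integer_minimum (cubic a' b' c' d')"
      unfolding L A by (rule integer_minimum_column_lattice[OF A(1)]) (simp add: eval sub)
    then show "m \<in> {integer_minimum (cubic a b c d) | a b c d.
        cubic_disc a b c d = cubic_discriminant P}"
      using sub(2) det disc by auto
  next
    fix m assume "m \<in> {integer_minimum (cubic a b c d) | a b c d.
        cubic_disc a b c d = cubic_discriminant P}"
    then obtain a' b' c' d' where m: "m = integer_minimum (cubic a' b' c' d')"
      and disc': "cubic_disc a' b' c' d' = cubic_discriminant P" by blast
    obtain p q r s where nf: "\<forall>x y. cubic a b c d x y = cubic 1 0 1 0 (p * x + q * y) (r * x + s * y)"
      "(p * s - q * r) ^ 6 = - cubic_disc a b c d / 4"
      using cubic_normal_form[OF neg] by blast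
    obtain p' q' r' s' where nf': "\<forall>x y. cubic a' b' c' d' x y
        = cubic 1 0 1 0 (p' * x + q' * y) (r' * x + s' * y)"
      "(p' * s' - q' * r') ^ 6 = - cubic_disc a' b' c' d' / 4"
      using cubic_normal_form[of a' b' c' d'] disc' D by auto
    define \<delta> where "\<delta> = p * s - q * r"
    have "\<bar>p' * s' - q' * r'\<bar> ^ 6 = \<bar>\<delta>\<bar> ^ 6"
      using nf(2) nf'(2) disc disc' by (simp add: \<delta>_def)
    then have dets: "\<bar>p' * s' - q' * r'\<bar> = \<bar>\<delta>\<bar>"
      by (rule power_eq_imp_eq_base) auto
    have \<delta>: "\<delta> \<noteq> 0" using nf(2) neg by (auto simp: \<delta>_def)
    \<comment> \<open>the inverse of the first substitution times the second one\<close>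
    define A :: "real ^ 2 ^ 2" where
      "A = vector [vector [(s * p' - q * r') / \<delta>, (s * q' - q * s') / \<delta>],
                   vector [(p * r' - r * p') / \<delta>, (p * s' - r * q') / \<delta>]]"
    have "det A = (p * s - q * r) * (p' * s' - q' * r') / (\<delta> * \<delta>)"
      unfolding A_def det_2 by (simp add: add_divide_distrib diff_divide_distrib algebra_simps)
    also have "\<dots> = (p' * s' - q' * r') / \<delta>" using \<delta> by (simp flip: \<delta>_def)
    finally have det: "\<bar>det A\<bar> = 1" using dets \<delta> by (simp add: abs_divide)
    then have inv: "invertible A" by (auto simp: invertible_det_nz)
    have "(INF v\<in>column_lattice A - {0}. \<bar>form_eval P v\<bar>) = m"
      unfolding m
    proof (rule integer_minimum_column_lattice[OF inv])
      fix x y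
      have "p * (A $ 1 $ 1 * x + A $ 1 $ 2 * y) + q * (A $ 2 $ 1 * x + A $ 2 $ 2 * y)
          = \<delta> * (p' * x + q' * y) / \<delta>"
        unfolding A_def \<delta>_def by (simp add: add_divide_distrib diff_divide_distrib algebra_simps)
      moreover have "r * (A $ 1 $ 1 * x + A $ 1 $ 2 * y) + s * (A $ 2 $ 1 * x + A $ 2 $ 2 * y)
          = \<delta> * (r' * x + s' * y) / \<delta>"
        unfolding A_def \<delta>_def by (simp add: add_divide_distrib diff_divide_distrib algebra_simps)
      ultimately show "form_eval P (vector [A $ 1 $ 1 * x + A $ 1 $ 2 * y, A $ 2 $ 1 * x + A $ 2 $ 2 * y])
          = cubic a' b' c' d' x y"
        using \<delta> by (simp add: eval nf(1) nf'(1))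
    qed
    moreover have "unimodular_lattice (column_lattice A)"
      unfolding unimodular_lattice_def is_lattice_def
      using inv det covolume_column_lattice[OF inv] by auto
    ultimately show "m \<in> Spec P" unfolding Spec_def by blast
  qed
qed

section \<open>The spectrum of a cubic form with negative discriminant\<close>

theorem theorem1p4:
  fixes P :: "real poly poly"
  assumes "binary_form 3 P"
    and "cubic_discriminant P < 0"
  shows "Spec P = {0 .. root 4 (- cubic_discriminant P / 23)}"
proof -
  define D where "D = cubic_discriminant P"
  have D: "D < 0" using assms by (simp add: D_def)
  have "m \<in> Spec P \<longleftrightarrow> m \<in> {0 .. root 4 (- D / 23)}" for m
  proof
    assume "m \<in> Spec P"
    then obtain a b c d where m: "m = integer_minimum (cubic a b c d)" and disc: "cubic_disc a b c d = D"
      unfolding Spec_eq_integer_minima[OF assms] D_def by blast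
    have "0 \<le> m" unfolding m by (rule integer_minimum_nonneg)
    moreover have "m \<le> root 4 (- D / 23)"
    proof (cases "m = 0")
      case True
      then show ?thesis using D by simp
    next
      case False
      with \<open>0 \<le> m\<close> have m0: "0 < m" by simp
      have disc': "cubic_disc (1 / m * a) (1 / m * b) (1 / m * c) (1 / m * d) = D / m ^ 4"
        unfolding cubic_disc_scale disc by (simp add: power_one_over)
      have "integer_form_bound (cubic (1 / m * a) (1 / m * b) (1 / m * c) (1 / m * d))"
        unfolding integer_form_bound_def
      proof (intro allI impI)
        fix x y :: int
        assume "(x, y) \<noteq> (0, 0)"
        then have "m \<le> \<bar>cubic a b c d x y\<bar>" unfolding m by (rule integer_minimum_le)
        then have "1 \<le> \<bar>1 / m * cubic a b c d x y\<bar>" using m0 by (simp add: abs_mult)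
        also have "1 / m * cubic a b c d x y
            = cubic (1 / m * a) (1 / m * b) (1 / m * c) (1 / m * d) x y"
          by (simp add: cubic_def add_divide_distrib)
        finally show "1 \<le> \<bar>cubic (1 / m * a) (1 / m * b) (1 / m * c) (1 / m * d) x y\<bar>" .
      qed
      then have "D / m ^ 4 \<le> - 23"
        using cubic_disc_upper_bound[of "1 / m * a" "1 / m * b" "1 / m * c" "1 / m * d"] D m0
        unfolding disc' by (simp add: divide_neg_pos)
      then have "m ^ 4 \<le> - D / 23" using m0 by (simp add: field_simps)
      then have "root 4 (m ^ 4) \<le> root 4 (- D / 23)" by simp
      then show ?thesis using m0 by (simp add: real_root_power_cancel)
    qed
    ultimately show "m \<in> {0 .. root 4 (- D / 23)}" by simp
  next
    assume m: "m \<in> {0 .. root 4 (- D / 23)}"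
    have "\<exists>a b c d. cubic_disc a b c d = D \<and> integer_minimum (cubic a b c d) = m"
    proof (cases "m = 0")
      case True
      have "integer_minimum (cubic 0 1 0 (- D / 4)) \<le> \<bar>cubic 0 1 0 (- D / 4) (of_int 1) (of_int 0)\<bar>"
        by (rule integer_minimum_le) simp
      then have "integer_minimum (cubic 0 1 0 (- D / 4)) = 0"
        using integer_minimum_nonneg[of "cubic 0 1 0 (- D / 4)"] by (simp add: cubic_def)
      moreover have "cubic_disc 0 1 0 (- D / 4) = D" by (simp add: cubic_disc_def)
      ultimately show ?thesis using True by blast
    next
      case False
      with m have m0: "0 < m" by simp
      have "m ^ 4 \<le> root 4 (- D / 23) ^ 4" using m m0 by (intro power_mono) auto
      also have "\<dots> = - D / 23" using D by (intro real_root_pow_pos2) auto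
      finally have "D / m ^ 4 \<le> - 23" using m0 by (simp add: field_simps)
      then obtain a b c d where f: "cubic_disc a b c d = D / m ^ 4"
        "integer_form_bound (cubic a b c d)" "cubic a b c d 1 0 = 1"
        by (rule cubic_with_minimum_one)
      have scale: "cubic (m * a) (m * b) (m * c) (m * d) x y = m * cubic a b c d x y" for x y
        by (simp add: cubic_def algebra_simps)
      have "integer_minimum (cubic (m * a) (m * b) (m * c) (m * d))
          \<le> \<bar>cubic (m * a) (m * b) (m * c) (m * d) (of_int 1) (of_int 0)\<bar>"
        by (rule integer_minimum_le) simp
      then have "integer_minimum (cubic (m * a) (m * b) (m * c) (m * d)) \<le> m"
        using f(3) m0 by (simp add: scale)
      moreover have "m \<le> integer_minimum (cubic (m * a) (m * b) (m * c) (m * d))"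
        using f(2) m0 unfolding integer_form_bound_def
        by (intro integer_minimum_ge) (simp add: scale abs_mult)
      moreover have "cubic_disc (m * a) (m * b) (m * c) (m * d) = D"
        unfolding cubic_disc_scale f(1) using m0 by simp
      ultimately show ?thesis by (intro exI conjI) auto
    qed
    then show "m \<in> Spec P" unfolding Spec_eq_integer_minima[OF assms] D_def by blast
  qed
  then show ?thesis unfolding D_def by blast
qed

end
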